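(* Let $\tilde P_c$ be a feasible vector of power demands, and let $\tilde V_L$ be an associated operating point (i.e., $\tilde V_L>\mathbf 0$ and $\tilde P_c=P_c(\tilde V_L)$). The following statements are equivalent: (i) $\tilde V_L$ is long-term voltage semi-stable (i.e., $\tilde V_L\in\operatorname{cl}(\mathcal D)$); (ii) $\tilde V_L$ is the unique long-term voltage semi-stable operating point associated to $\tilde P_c$; (iii) $\tilde V_L$ is dissipation-minimizing; (iv) $\tilde V_L$ is the unique dissipation-minimizing operating point associated to $\tilde P_c$; (v) $\tilde V_L$ is a high-voltage solution; (vi) $\tilde V_L$ is a strict high-voltage solution.
   Context: Notation: $[x]=\operatorname{diag}(x_1,\dots,x_k)$ for a vector $x$; $\mathbf 0$ is the all-zeros vector; vector and matrix inequalities are element-wise. Setting: a DC power grid with $n\ge1$ loads and $m\ge1$ sources. Its Kirchhoff matrix $Y=\begin{pmatrix} Y_{LL} & Y_{LS} \\ Y_{SL} & Y_{SS} \end{pmatrix}\in\mathbb R^{(n+m)\times(n+m)}$ is the weighted Laplacian of a connected undirected graph with positive edge weights (symmetric, nonpositive off-diagonal entries, zero row sums), partitioned according to loads and sources, and the $n\times n$ matrix $Y_{LL}$ is irreducible; hence $Y_{LL}$ is symmetric positive definite with nonpositive off-diagonal entries. The source voltages $V_S\in\mathbb R^m$, $V_S>\mathbf 0$, are fixed. Put $\mathcal I_L^*=-Y_{LS}V_S$ (which satisfies $\mathcal I_L^*\ge\mathbf 0$, $\mathcal I_L^*\ne\mathbf 0$) and $V_L^*=Y_{LL}^{-1}\mathcal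 I_L^*$ (which satisfies $V_L^*>\mathbf 0$). For $V_L\in\mathbb R^n$ put $P_c(V_L)=[V_L]Y_{LL}(V_L^*-V_L)$, with Jacobian $\frac{\partial P_c}{\partial V_L}(V_L)=[Y_{LL}(V_L^*-V_L)]-[V_L]Y_{LL}$. An operating point associated to $\tilde P_c\in\mathbb R^n$ is a vector $V_L>\mathbf 0$ with $P_c(V_L)=\tilde P_c$; $\tilde P_c$ is feasible if it has an associated operating point. $\mathcal D$ is the set of all $V_L>\mathbf 0$ such that $\frac{\partial P_c}{\partial V_L}(V_L)$ is nonsingular and its inverse has only negative entries, and $\operatorname{cl}(\mathcal D)$ is its closure in $\mathbb R^n$; elements of $\operatorname{cl}(\mathcal D)$ are called long-term voltage semi-stable operating points. The total dissipated power is $R(V_L,V_S)=V^\top Y V$ with $V=\begin{pmatrix} V_L \\ V_S \end{pmatrix}$. An operating point $\tilde V_L$ associated to $\tilde P_c$ is: dissipation-minimizing if $R(\tilde V_L,V_S)\le R(V_L,V_S)$ for all operating points $V_L$ associated to $\tilde P_c$; a high-voltage solution if $\tilde V_L\ge V_L$ for all operating points $V_L$ associated to $\tilde P_c$; a strict high-voltage solution if $\tilde V_L>V_L$ for all operating points $V_L\neq\tilde V_L$ associated to $\tilde P_c$. *)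

theory Defs
  imports "HOL-Analysis.Analysis"
begin

text \<open>
  Loads are indexed by a finite type \<open>'l\<close>, sources by a finite type \<open>'s\<close>, and the nodes of the grid
  by \<open>'l + 's\<close>. The library order \<open>\<le>\<close> on \<open>real ^ 'n\<close> is componentwise, but the library \<open><\<close> is
  only the strict part of that order, so the componentwise strict order is introduced separately.
\<close>

definition vec_less :: "real ^ 'n \<Rightarrow> real ^ 'n \<Rightarrow> bool" (infix \<open>\<lless>\<close> 50) where
  "x \<lless> y \<longleftrightarrow> (\<forall>i. x $ i < y $ i)"

definition diag :: "real ^ 'n \<Rightarrow> real ^ 'n ^ 'n" where
  "diag x = (\<chi> i j. if i = j then x $ i else 0)"

definition irreducible_mat :: "real ^ 'n ^ 'n \<Rightarrow> bool" where
  "irreducible_mat A \<longleftrightarrow>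
     (\<forall>S. S \<noteq> {} \<and> S \<noteq> UNIV \<longrightarrow> (\<exists>i\<in>S. \<exists>j\<in>-S. A $ i $ j \<noteq> 0))"

text \<open>
  Weighted Laplacians of connected undirected graphs with positive edge weights: distinct nodes
  \<open>i\<close> and \<open>j\<close> are adjacent iff \<open>Y $ i $ j < 0\<close>, the edge weight being \<open>- Y $ i $ j\<close>.
\<close>

definition kirchhoff_matrix :: "real ^ 'n ^ 'n \<Rightarrow> bool" where
  "kirchhoff_matrix Y \<longleftrightarrow>
     transpose Y = Y \<and>
     (\<forall>i j. i \<noteq> j \<longrightarrow> Y $ i $ j \<le> 0) \<and>
     (\<forall>i. (\<Sum>j\<in>UNIV. Y $ i $ j) = 0) \<and>
     (\<forall>i j. (i, j) \<in> {(k, l). k \<noteq> l \<and> Y $ k $ l < 0}\<^sup>*)"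

definition Y_LL :: "real ^ ('l::finite + 's::finite) ^ ('l + 's) \<Rightarrow> real ^ 'l ^ 'l" where
  "Y_LL Y = (\<chi> i j. Y $ Inl i $ Inl j)"

definition Y_LS :: "real ^ ('l::finite + 's::finite) ^ ('l + 's) \<Rightarrow> real ^ 's ^ 'l" where
  "Y_LS Y = (\<chi> i j. Y $ Inl i $ Inr j)"

definition dc_power_grid ::
  "real ^ ('l::finite + 's::finite) ^ ('l + 's) \<Rightarrow> real ^ 's \<Rightarrow> bool" where
  "dc_power_grid Y V\<^sub>S \<longleftrightarrow> kirchhoff_matrix Y \<and> irreducible_mat (Y_LL Y) \<and> 0 \<lless> V\<^sub>S"

definition I_star :: "real ^ ('l::finite + 's::finite) ^ ('l + 's) \<Rightarrow> real ^ 's \<Rightarrow> real ^ 'l" where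
  "I_star Y V\<^sub>S = - (Y_LS Y *v V\<^sub>S)"

definition V_star :: "real ^ ('l::finite + 's::finite) ^ ('l + 's) \<Rightarrow> real ^ 's \<Rightarrow> real ^ 'l" where
  "V_star Y V\<^sub>S = matrix_inv (Y_LL Y) *v I_star Y V\<^sub>S"

definition P_c ::
  "real ^ ('l::finite + 's::finite) ^ ('l + 's) \<Rightarrow> real ^ 's \<Rightarrow> real ^ 'l \<Rightarrow> real ^ 'l" where
  "P_c Y V\<^sub>S V\<^sub>L = diag V\<^sub>L *v (Y_LL Y *v (V_star Y V\<^sub>S - V\<^sub>L))"

definition operating_point ::
  "real ^ ('l::finite + 's::finite) ^ ('l + 's) \<Rightarrow> real ^ 's \<Rightarrow> real ^ 'l \<Rightarrow> real ^ 'l \<Rightarrow> bool" where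
  "operating_point Y V\<^sub>S P V\<^sub>L \<longleftrightarrow> 0 \<lless> V\<^sub>L \<and> P_c Y V\<^sub>S V\<^sub>L = P"

definition feasible ::
  "real ^ ('l::finite + 's::finite) ^ ('l + 's) \<Rightarrow> real ^ 's \<Rightarrow> real ^ 'l \<Rightarrow> bool" where
  "feasible Y V\<^sub>S P \<longleftrightarrow> (\<exists>V\<^sub>L. operating_point Y V\<^sub>S P V\<^sub>L)"

definition stable_set ::
  "real ^ ('l::finite + 's::finite) ^ ('l + 's) \<Rightarrow> real ^ 's \<Rightarrow> (real ^ 'l) set" where
  "stable_set Y V\<^sub>S =
     {V\<^sub>L. 0 \<lless> V\<^sub>L \<and>
           invertible (jacobian (P_c Y V\<^sub>S) (at V\<^sub>L)) \<and>
           (\<forall>i j. matrix_inv (jacobian (P_c Y V\<^sub>S) (at V\<^sub>L)) $ i $ j < 0)}"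

definition semi_stable ::
  "real ^ ('l::finite + 's::finite) ^ ('l + 's) \<Rightarrow> real ^ 's \<Rightarrow> real ^ 'l \<Rightarrow> bool" where
  "semi_stable Y V\<^sub>S V\<^sub>L \<longleftrightarrow> V\<^sub>L \<in> closure (stable_set Y V\<^sub>S)"

definition stack :: "real ^ 'l::finite \<Rightarrow> real ^ 's::finite \<Rightarrow> real ^ ('l + 's)" where
  "stack x y = (\<chi> k. case k of Inl i \<Rightarrow> x $ i | Inr j \<Rightarrow> y $ j)"

definition dissipation ::
  "real ^ ('l::finite + 's::finite) ^ ('l + 's) \<Rightarrow> real ^ 'l \<Rightarrow> real ^ 's \<Rightarrow> real" where
  "dissipation Y V\<^sub>L V\<^sub>S = stack V\<^sub>L V\<^sub>S \<bullet> (Y *v stack V\<^sub>L V\<^sub>S)"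

definition dissipation_minimizing ::
  "real ^ ('l::finite + 's::finite) ^ ('l + 's) \<Rightarrow> real ^ 's \<Rightarrow> real ^ 'l \<Rightarrow> real ^ 'l \<Rightarrow> bool" where
  "dissipation_minimizing Y V\<^sub>S P V \<longleftrightarrow>
     operating_point Y V\<^sub>S P V \<and>
     (\<forall>V\<^sub>L. operating_point Y V\<^sub>S P V\<^sub>L \<longrightarrow> dissipation Y V V\<^sub>S \<le> dissipation Y V\<^sub>L V\<^sub>S)"

definition high_voltage_solution ::
  "real ^ ('l::finite + 's::finite) ^ ('l + 's) \<Rightarrow> real ^ 's \<Rightarrow> real ^ 'l \<Rightarrow> real ^ 'l \<Rightarrow> bool" where
  "high_voltage_solution Y V\<^sub>S P V \<longleftrightarrow>
     operating_point Y V\<^sub>S P V \<and>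
     (\<forall>V\<^sub>L. operating_point Y V\<^sub>S P V\<^sub>L \<longrightarrow> V\<^sub>L \<le> V)"

definition strict_high_voltage_solution ::
  "real ^ ('l::finite + 's::finite) ^ ('l + 's) \<Rightarrow> real ^ 's \<Rightarrow> real ^ 'l \<Rightarrow> real ^ 'l \<Rightarrow> bool" where
  "strict_high_voltage_solution Y V\<^sub>S P V \<longleftrightarrow>
     operating_point Y V\<^sub>S P V \<and>
     (\<forall>V\<^sub>L. operating_point Y V\<^sub>S P V\<^sub>L \<and> V\<^sub>L \<noteq> V \<longrightarrow> V\<^sub>L \<lless> V)"

lemma diag_mult_vec: "diag x *v y = (\<chi> i. x $ i * y $ i)"
  by (simp add: diag_def matrix_vector_mult_def vec_eq_iff if_distrib[where f="\<lambda>a. a * _"]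
      cong: if_cong)

lemma jacobian_P_c:
  fixes Y :: "real ^ ('l::finite + 's::finite) ^ ('l + 's)"
  shows "P_c Y V\<^sub>S differentiable (at V\<^sub>L)"
    and "jacobian (P_c Y V\<^sub>S) (at V\<^sub>L) =
           diag (Y_LL Y *v (V_star Y V\<^sub>S - V\<^sub>L)) - diag V\<^sub>L ** Y_LL Y"
proof -
  let ?A = "Y_LL Y" and ?w = "V_star Y V\<^sub>S"
  let ?J = "diag (?A *v (?w - V\<^sub>L)) - diag V\<^sub>L ** ?A"
  have A: "((\<lambda>V. ?A *v (?w - V)) has_derivative (\<lambda>h. ?A *v (0 - h))) (at V\<^sub>L)"
    by (intro bounded_linear.has_derivative[OF matrix_vector_mul_bounded_linear]
        derivative_intros)
  have "((\<lambda>V. P_c Y V\<^sub>S V $ i) has_derivative (\<lambda>h. (?J *v h) $ i)) (at V\<^sub>L)" for i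
  proof -
    have "((\<lambda>V. V $ i * (?A *v (?w - V)) $ i) has_derivative
           (\<lambda>h. V\<^sub>L $ i * (?A *v (0 - h)) $ i + h $ i * (?A *v (?w - V\<^sub>L)) $ i)) (at V\<^sub>L)"
      by (intro has_derivative_mult bounded_linear.has_derivative[OF bounded_linear_vec_nth]
          A has_derivative_ident)
    moreover have "(?J *v h) $ i = V\<^sub>L $ i * (?A *v (0 - h)) $ i + h $ i * (?A *v (?w - V\<^sub>L)) $ i"
      for h
      using linear_neg[OF matrix_vector_mul_linear, of ?A h]
      by (simp add: matrix_vector_mult_diff_rdistrib diag_mult_vec
          matrix_vector_mul_assoc[symmetric] matrix_vector_mult_diff_distrib algebra_simps)
    ultimately show ?thesis
      by (simp add: P_c_def diag_mult_vec)
  qed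
  then have D: "(P_c Y V\<^sub>S has_derivative (\<lambda>h. ?J *v h)) (at V\<^sub>L)"
    by (subst has_derivative_componentwise_within)
       (auto simp: Basis_vec_def inner_axis)
  then show "P_c Y V\<^sub>S differentiable (at V\<^sub>L)"
    by (rule differentiableI)
  show "jacobian (P_c Y V\<^sub>S) (at V\<^sub>L) = ?J"
    unfolding jacobian_def frechet_derivative_at[OF D, symmetric] by simp
qed

end

theory Submission
  imports Defs
begin

text \<open>
  With \<open>A = Y\<^sub>L\<^sub>L\<close>, \<open>b = I\<^sub>L\<^sup>*\<close> the Jacobian is \<open>- [x] S(x)\<close>, where \<open>S(x) = A + [(A x - b) / x]\<close> is symmetric,
  irreducible and has nonpositive off-diagonal entries. By Perron-Frobenius for such matrices, the
  stable set is \<open>{x > 0. S(x) positive definite}\<close>; since \<open>S(s x) = S(x) + (1 - 1/s) [b / x]\<close>, the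
  positive points of its closure are those where \<open>S(x)\<close> is positive semidefinite.

  If \<open>V\<close>, \<open>W\<close> are distinct operating points for the same demand and \<open>u > 0\<close> satisfies \<open>S(V) u \<ge> 0\<close>,
  then the demand weighted by \<open>\<kappa> = u / V\<close> is a strictly concave function of the voltages, whence
  \<open>S(V) u \<bullet> (V - W) > 0\<close>. If \<open>S(V)\<close> is semidefinite it is therefore nonsingular or \<open>V\<close> is the only
  operating point, and choosing \<open>S(V) u\<close> to be the unit vectors gives \<open>V > W\<close>. A semi-stable
  operating point exists: it maximizes the sum of the voltages over all \<open>x \<ge> V\<close> that meet at least
  the demand. On operating points the dissipation is a constant minus \<open>b \<bullet> x\<close>, so the
  dominating point is also the unique dissipation minimizer.
\<close>

section \<open>Perron-Frobenius theory of irreducible symmetric Z-matrices\<close>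

text \<open>The diagonal is left free, so the class is closed under adding diagonal matrices. The
  positive definite members are the irreducible Stieltjes matrices.\<close>

definition symmetric_Z_matrix :: "real ^ 'n ^ 'n \<Rightarrow> bool" where
  "symmetric_Z_matrix A \<longleftrightarrow>
     transpose A = A \<and> (\<forall>i j. i \<noteq> j \<longrightarrow> A $ i $ j \<le> 0) \<and> irreducible_mat A"

lemma inner_symmetric_matrix:
  fixes A :: "real ^ 'n::finite ^ 'n"
  assumes "transpose A = A"
  shows "x \<bullet> (A *v y) = (A *v x) \<bullet> y"
  using assms by (metis dot_lmul_matrix transpose_matrix_vector)

text \<open>A strong minimum principle. If \<open>z\<close> had zeros, irreducibility would give a
  nonzero entry of \<open>A\<close> from a zero \<open>k\<close> of \<open>z\<close> to a nonzero
  \<open>j\<close>. All terms of row \<open>k\<close> of \<open>A *v z\<close> are then nonpositive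
  and the one at \<open>j\<close> is negative, so \<open>(A *v z) $ k < 0\<close>.\<close>

lemma irreducible_pos_of_nonneg:
  fixes A :: "real ^ 'n::finite ^ 'n"
  assumes off: "\<And>i j. i \<noteq> j \<Longrightarrow> A $ i $ j \<le> 0" and irr: "irreducible_mat A"
    and z: "\<And>i. 0 \<le> z $ i" "z \<noteq> 0"
    and Az: "\<And>i. z $ i = 0 \<Longrightarrow> 0 \<le> (A *v z) $ i"
  shows "0 < z $ i"
proof (rule ccontr)
  assume "\<not> 0 < z $ i"
  then have "i \<in> {i. z $ i = 0}"
    using z(1)[of i] by simp
  moreover have "{i. z $ i = 0} \<noteq> UNIV"
    using z(2) by (auto simp: vec_eq_iff)
  ultimately obtain k j where k: "z $ k = 0" and j: "z $ j \<noteq> 0" and kj: "A $ k $ j \<noteq> 0"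
    using irr unfolding irreducible_mat_def by (metis (mono_tags, lifting) Compl_iff empty_iff mem_Collect_eq)
  have le: "A $ k $ l * z $ l \<le> 0" for l
    using off[of k l] z(1)[of l] k by (cases "l = k") (auto simp: mult_nonpos_nonneg)
  have "A $ k $ j < 0" "0 < z $ j"
    using off[of k j] z(1)[of j] k j kj by fastforce+
  then have "A $ k $ j * z $ j < 0"
    by (rule mult_neg_pos)
  then have "(\<Sum>l\<in>UNIV. A $ k $ l * z $ l) < (\<Sum>l\<in>(UNIV::'n set). 0)"
    using le by (intro sum_strict_mono_ex1) auto
  with Az[OF k] show False
    by (simp add: matrix_vector_mult_def)
qed

text \<open>The form \<open>u \<bullet> (A *v u) - \<mu> * (u \<bullet> u)\<close> is nonnegative
  and vanishes at \<open>w\<close>. A short step from \<open>w\<close> against half its gradient,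
  \<open>g\<close>, would make it negative unless \<open>g = 0\<close>.\<close>

lemma rayleigh_minimizer_eigenvector:
  fixes A :: "real ^ 'n::finite ^ 'n"
  assumes sym: "transpose A = A"
    and min: "\<And>u. \<mu> * (u \<bullet> u) \<le> u \<bullet> (A *v u)"
    and w: "w \<bullet> (A *v w) = \<mu> * (w \<bullet> w)"
  shows "A *v w = \<mu> *\<^sub>R w"
proof (rule ccontr)
  assume "A *v w \<noteq> \<mu> *\<^sub>R w"
  define g where "g = A *v w - \<mu> *\<^sub>R w"
  define q where "q = g \<bullet> (A *v g) - \<mu> * (g \<bullet> g)"
  have g: "0 < g \<bullet> g"
    using \<open>A *v w \<noteq> \<mu> *\<^sub>R w\<close> by (simp add: g_def)
  have gg: "g \<bullet> g = g \<bullet> (A *v w) - \<mu> * (g \<bullet> w)"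
    by (simp add: g_def inner_diff_right)
  have "2 * (g \<bullet> g) \<le> t * q" if t: "0 < t" for t
  proof -
    let ?u = "w - t *\<^sub>R g"
    have "?u \<bullet> (A *v ?u) - \<mu> * (?u \<bullet> ?u) =
        t * (t * q) - t * (2 * (g \<bullet> (A *v w) - \<mu> * (g \<bullet> w)))"
      using w inner_symmetric_matrix[OF sym, of w g] unfolding q_def
      by (simp add: matrix_vector_mult_diff_distrib matrix_vector_mult_scaleR inner_diff_left inner_diff_right
          inner_commute algebra_simps)
    with min[of ?u] gg have "t * (2 * (g \<bullet> g)) \<le> t * (t * q)"
      by simp
    with t show ?thesis by simp
  qed
  moreover have "0 \<le> q"
    using min[of g] by (simp add: q_def)
  \<comment> \<open>The step length is \<open>t = (g \<bullet> g) / (q + 1)\<close>, small enough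
    for \<open>t * q \<le> g \<bullet> g\<close>; the summand 1 covers the case
    \<open>q = 0\<close>.\<close>
  ultimately have "2 * (g \<bullet> g) \<le> (g \<bullet> g) / (q + 1) * q"
    using g by (metis add_nonneg_pos divide_pos_pos zero_less_one)
  also have "\<dots> \<le> g \<bullet> g"
    using g \<open>0 \<le> q\<close> by (simp add: divide_simps)
  finally show False
    using g by simp
qed

text \<open>The minimum \<mu> of the Rayleigh quotient is the smallest eigenvalue, and its sign
  decides definiteness. Replacing a minimizer by its absolute values gives a nonnegative
  eigenvector, which irreducibility makes positive.\<close>

lemma symmetric_Z_matrix_perron:
  fixes A :: "real ^ 'n::finite ^ 'n"
  assumes "symmetric_Z_matrix A"
  obtains \<mu> w where "0 \<lless> w" "A *v w = \<mu> *\<^sub>R w" "\<And>u. \<mu> * (u \<bullet> u) \<le> u \<bullet> (A *v u)"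
proof -
  have sym: "transpose A = A" and off: "\<And>i j. i \<noteq> j \<Longrightarrow> A $ i $ j \<le> 0" and irr: "irreducible_mat A"
    using assms by (auto simp: symmetric_Z_matrix_def)
  have "axis undefined 1 \<in> sphere (0::real^'n) 1"
    by simp
  then have "sphere (0::real^'n) 1 \<noteq> {}" by blast
  moreover have "continuous_on (sphere 0 1) (\<lambda>u. u \<bullet> (A *v u))"
    by (intro continuous_on_inner continuous_on_id linear_continuous_on matrix_vector_mul_bounded_linear)
  ultimately obtain v where v: "v \<in> sphere (0::real^'n) 1"
    and min: "\<And>u. u \<in> sphere 0 1 \<Longrightarrow> v \<bullet> (A *v v) \<le> u \<bullet> (A *v u)"
    using continuous_attains_inf[OF compact_sphere, of 0 1 "\<lambda>u. u \<bullet> (A *v u)"] by blast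
  define \<mu> where "\<mu> = v \<bullet> (A *v v)"
  have ray: "\<mu> * (u \<bullet> u) \<le> u \<bullet> (A *v u)" for u
  proof (cases "u = 0")
    case False
    let ?u = "(1 / norm u) *\<^sub>R u"
    have "\<mu> \<le> ?u \<bullet> (A *v ?u)"
      unfolding \<mu>_def using False by (intro min) simp
    also have "\<dots> = u \<bullet> (A *v u) / (norm u)\<^sup>2"
      by (simp add: matrix_vector_mult_scaleR power2_eq_square)
    finally show ?thesis
      using False by (simp add: power2_norm_eq_inner divide_simps mult.commute)
  qed simp
  \<comment> \<open>Taking absolute values does not increase the quadratic form of a Z-matrix.\<close>
  define w where "w = (\<chi> i. \<bar>v $ i\<bar>)"
  have ww: "w \<bullet> w = v \<bullet> v"
    by (simp add: w_def inner_vec_def abs_mult_self_eq)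
  have vv: "v \<bullet> v = 1"
    using v by (simp add: norm_eq_1)
  have "w \<bullet> (A *v w) \<le> v \<bullet> (A *v v)"
    unfolding inner_vec_def matrix_vector_mult_def
  proof (simp add: sum_distrib_left, intro sum_mono)
    fix i j
    show "w $ i * (A $ i $ j * w $ j) \<le> v $ i * (A $ i $ j * v $ j)"
    proof (cases "i = j")
      case False
      have "v $ i * v $ j \<le> w $ i * w $ j"
        by (simp add: w_def abs_mult[symmetric])
      then show ?thesis
        unfolding mult.left_commute[of "w $ i"] mult.left_commute[of "v $ i"]
        by (rule mult_left_mono_neg[OF _ off[OF False]])
    next
      case True
      have "w $ i * w $ i = v $ i * v $ i"
        by (simp add: w_def abs_mult_self_eq)
      then show ?thesis
        unfolding True by (simp add: mult.left_commute[of _ "A $ j $ j"])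
    qed
  qed
  then have "w \<bullet> (A *v w) = \<mu> * (w \<bullet> w)"
    using ray[of w] by (simp add: \<mu>_def ww vv)
  with sym ray have eig: "A *v w = \<mu> *\<^sub>R w"
    by (rule rayleigh_minimizer_eigenvector)
  have "w \<noteq> 0"
    using ww vv by auto
  moreover have "0 \<le> w $ i" for i
    by (simp add: w_def)
  \<comment> \<open>At a zero of \<open>w\<close> the eigenvalue equation gives
    \<open>(A *v w) $ i = 0\<close>, whatever the sign of \<mu>.\<close>
  ultimately have "0 < w $ i" for i
    by (intro irreducible_pos_of_nonneg[OF off irr]) (simp_all add: eig)
  then have "0 \<lless> w"
    by (simp add: vec_less_def)
  with eig ray show ?thesis
    using that by blast
qed

lemma inner_pos:
  fixes w c :: "real ^ 'n::finite"
  assumes "0 \<lless> w" "\<And>i. 0 \<le> c $ i" "c \<noteq> 0"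
  shows "0 < w \<bullet> c"
proof -
  obtain i where "c $ i \<noteq> 0"
    using assms(3) by (auto simp: vec_eq_iff)
  then have "0 < w $ i * c $ i"
    using assms(1) assms(2)[of i] by (auto simp: vec_less_def intro!: mult_pos_pos)
  then show ?thesis
    unfolding inner_vec_def
    using assms by (intro sum_pos2[of _ i]) (auto simp: vec_less_def less_imp_le)
qed

text \<open>Pairing \<open>A *v x\<close> with the Perron vector \<open>w\<close> gives
  \<open>0 < w \<bullet> (A *v x) = \<mu> * (w \<bullet> x)\<close>, so the smallest eigenvalue is
  positive.\<close>

lemma Z_matrix_semipositive_pos_def:
  fixes A :: "real ^ 'n::finite ^ 'n"
  assumes A: "symmetric_Z_matrix A" and x: "0 \<lless> x"
    and Ax: "\<And>i. 0 \<le> (A *v x) $ i" "A *v x \<noteq> 0"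
  obtains \<mu> where "0 < \<mu>" "\<And>u. \<mu> * (u \<bullet> u) \<le> u \<bullet> (A *v u)"
proof -
  obtain \<mu> w where w: "0 \<lless> w" "A *v w = \<mu> *\<^sub>R w" and ray: "\<And>u. \<mu> * (u \<bullet> u) \<le> u \<bullet> (A *v u)"
    using symmetric_Z_matrix_perron[OF A] by metis
  have "0 < w \<bullet> (A *v x)"
    using w(1) Ax by (rule inner_pos)
  also have "\<dots> = \<mu> * (w \<bullet> x)"
    using A by (simp add: symmetric_Z_matrix_def inner_symmetric_matrix w(2))
  finally have "0 < \<mu> * (w \<bullet> x)" .
  moreover have "0 \<le> w \<bullet> x"
    using w(1) x by (auto simp: inner_vec_def vec_less_def less_imp_le intro!: sum_nonneg)
  ultimately have "0 < \<mu>"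
    using zero_less_mult_pos2 by (metis mult_zero_right order_less_le)
  with ray show ?thesis
    using that by blast
qed

text \<open>Comparison with the Perron vector: take the largest \<open>r\<close> with
  \<open>r *\<^sub>R w\<close> below \<open>y\<close>. If \<open>r \<le> 0\<close>, the difference
  \<open>z\<close> is nonnegative with a zero and \<open>A *v z\<close> is nonnegative, so
  \<open>z = 0\<close>; then \<open>A *v y\<close> is a nonpositive multiple of \<open>w\<close>,
  contrary to the assumptions on it.\<close>

lemma Z_matrix_inverse_positive:
  fixes A :: "real ^ 'n::finite ^ 'n"
  assumes A: "symmetric_Z_matrix A"
    and w: "0 \<lless> w" "A *v w = \<mu> *\<^sub>R w" "0 < \<mu>"
    and y: "\<And>i. 0 \<le> (A *v y) $ i" "A *v y \<noteq> 0"
  shows "0 \<lless> y"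
proof -
  have off: "\<And>i j. i \<noteq> j \<Longrightarrow> A $ i $ j \<le> 0" and irr: "irreducible_mat A"
    using A by (auto simp: symmetric_Z_matrix_def)
  have wpos: "0 < w $ i" for i
    using w(1) by (simp add: vec_less_def)
  define r where "r = Min (range (\<lambda>i. y $ i / w $ i))"
  have "r \<in> range (\<lambda>i. y $ i / w $ i)"
    unfolding r_def by (intro Min_in) auto
  then obtain k where k: "r = y $ k / w $ k" by auto
  have rle: "r \<le> y $ i / w $ i" for i
    unfolding r_def by (intro Min_le) auto
  have "0 < r"
  proof (rule ccontr)
    assume "\<not> 0 < r"
    define z where "z = y - r *\<^sub>R w"
    have Az: "A *v z = A *v y - (r * \<mu>) *\<^sub>R w"
      by (simp add: z_def matrix_vector_mult_diff_distrib matrix_vector_mult_scaleR w(2))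
    have rmw: "r * \<mu> * w $ i \<le> 0" for i
      using \<open>\<not> 0 < r\<close> w(3) wpos[of i] by (simp add: mult_nonpos_nonneg less_imp_le)
    have z0: "0 \<le> z $ i" for i
      using rle[of i] wpos[of i] by (simp add: z_def pos_le_divide_eq)
    have zk: "z $ k = 0"
      using k wpos[of k] by (simp add: z_def)
    have "z = 0"
    proof (rule ccontr)
      assume "z \<noteq> 0"
      have "0 \<le> (A *v z) $ i" for i
        using y(1)[of i] rmw[of i] by (simp add: Az)
      then have "0 < z $ k"
        using irreducible_pos_of_nonneg[OF off irr z0 \<open>z \<noteq> 0\<close>] by blast
      with zk show False by simp
    qed
    then have "A *v y = (r * \<mu>) *\<^sub>R w"
      using Az by simp
    then have "(A *v y) $ i = 0" for i
      using y(1)[of i] rmw[of i] by simp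
    with y(2) show False
      by (simp add: vec_eq_iff)
  qed
  then have "0 < y $ i" for i
    using rle[of i] wpos[of i] by (meson less_le_trans zero_less_divide_iff not_less_iff_gr_or_eq)
  then show ?thesis
    by (simp add: vec_less_def)
qed

lemma pos_def_invertible:
  fixes A :: "real ^ 'n::finite ^ 'n"
  assumes "0 < \<mu>" "\<And>u. \<mu> * (u \<bullet> u) \<le> u \<bullet> (A *v u)"
  shows "invertible A"
proof -
  have "x = 0" if "A *v x = 0" for x
    using assms(2)[of x] that mult_pos_pos[OF assms(1), of "x \<bullet> x"] by fastforce
  then show ?thesis
    by (simp add: invertible_left_inverse matrix_left_invertible_ker)
qed

lemma matrix_inv_mult_vec:
  fixes A :: "real ^ 'n::finite ^ 'n"
  assumes "invertible A"
  shows "A *v (matrix_inv A *v x) = x" "matrix_inv A *v (A *v x) = x"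
proof -
  have "A ** matrix_inv A = mat 1 \<and> matrix_inv A ** A = mat 1"
    using assms unfolding invertible_def matrix_inv_def by (rule someI_ex)
  then show "A *v (matrix_inv A *v x) = x" "matrix_inv A *v (A *v x) = x"
    by (simp_all add: matrix_vector_mul_assoc)
qed

section \<open>Comparison and existence of operating points\<close>

definition balance :: "real ^ 'n ^ 'n \<Rightarrow> real ^ 'n \<Rightarrow> real ^ 'n \<Rightarrow> real ^ 'n \<Rightarrow> bool" where
  "balance A b p x \<longleftrightarrow> 0 \<lless> x \<and> (\<forall>i. x $ i * (b - A *v x) $ i = p $ i)"

text \<open>Dividing row \<open>i\<close> of the Jacobian by \<open>- x $ i\<close> symmetrizes it
  when \<open>A\<close> is symmetric, so that stability becomes a question of definiteness.\<close>

definition sensitivity :: "real ^ 'n ^ 'n \<Rightarrow> real ^ 'n \<Rightarrow> real ^ 'n \<Rightarrow> real ^ 'n ^ 'n" where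
  "sensitivity A b x = A + diag (\<chi> i. (A *v x - b) $ i / x $ i)"

lemma sensitivity_mult_nth:
  "(sensitivity A b x *v y) $ i = (A *v y) $ i + (A *v x - b) $ i / x $ i * y $ i"
  by (simp add: sensitivity_def matrix_vector_mult_add_rdistrib diag_mult_vec)

lemma symmetric_Z_matrix_sensitivity:
  assumes "symmetric_Z_matrix A"
  shows "symmetric_Z_matrix (sensitivity A b x)"
proof -
  have off: "sensitivity A b x $ i $ j = A $ i $ j" if "i \<noteq> j" for i j
    using that by (simp add: sensitivity_def diag_def)
  have "transpose (sensitivity A b x) = sensitivity A b x"
    using assms by (simp add: symmetric_Z_matrix_def sensitivity_def diag_def transpose_def vec_eq_iff)
  moreover have "irreducible_mat (sensitivity A b x)"
    using assms unfolding symmetric_Z_matrix_def irreducible_mat_def by (metis ComplD off)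
  ultimately show ?thesis
    using assms by (simp add: symmetric_Z_matrix_def off)
qed

text \<open>The \<kappa>-weighted demand is a quadratic function with equal values at
  \<open>V\<close> and \<open>W\<close>, gradient \<open>- (S *v u)\<close> at \<open>V\<close> and
  Hessian \<open>- B\<close>. Its exact Taylor expansion therefore reads
  \<open>h \<bullet> (B *v h) = 2 * ((S *v u) \<bullet> h)\<close>, and \<open>B\<close> is positive
  definite.\<close>

lemma balance_inner_pos:
  fixes A :: "real ^ 'n::finite ^ 'n"
  assumes A: "symmetric_Z_matrix A" and b: "\<And>i. 0 \<le> b $ i" "b \<noteq> 0"
    and V: "balance A b p V" and W: "balance A b p W" and "V \<noteq> W"
    and u: "0 \<lless> u" and Su: "\<And>i. 0 \<le> (sensitivity A b V *v u) $ i"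
  shows "0 < (sensitivity A b V *v u) \<bullet> (V - W)"
proof -
  define S where "S = sensitivity A b V"
  define h where "h = V - W"
  \<comment> \<open>The weights are chosen so that multiplying \<open>V\<close> by them entrywise
    gives back \<open>u\<close>.\<close>
  define \<kappa> where "\<kappa> = (\<chi> i. u $ i / V $ i)"
  \<comment> \<open>\<open>- B\<close> is the Hessian of \<open>x \<mapsto> \<kappa> \<bullet> [x] (b - A x)\<close>, and \<open>B V = S u + [\<kappa>] b\<close>
    certifies its definiteness.\<close>
  define B :: "real ^ 'n ^ 'n" where "B = (\<chi> i j. \<kappa> $ i * A $ i $ j + A $ i $ j * \<kappa> $ j)"
  have symA: "transpose A = A"
    using A by (simp add: symmetric_Z_matrix_def)
  have Aij: "A $ j $ i = A $ i $ j" for i j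
    using symA by (metis transpose_def vec_lambda_beta)
  have Vpos: "0 < V $ i" for i
    using V by (simp add: balance_def vec_less_def)
  then have lpos: "0 < \<kappa> $ i" for i
    using u by (simp add: \<kappa>_def vec_less_def)
  have Bx: "(B *v x) $ i = \<kappa> $ i * (A *v x) $ i + (A *v (\<chi> j. \<kappa> $ j * x $ j)) $ i" for x i
    by (simp add: B_def matrix_vector_mult_def sum_distrib_left sum.distrib algebra_simps)
  have Bij: "B $ i $ j = (\<kappa> $ i + \<kappa> $ j) * A $ i $ j" for i j
    by (simp add: B_def algebra_simps)
  have "B $ i $ j \<noteq> 0" if "A $ i $ j \<noteq> 0" for i j
    using that lpos[of i] lpos[of j] by (simp add: Bij)
  moreover have "B $ i $ j \<le> 0" if "i \<noteq> j" for i j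
    using A that lpos[of i] lpos[of j] unfolding Bij symmetric_Z_matrix_def
    by (intro mult_nonneg_nonpos) (auto simp: less_imp_le)
  moreover have "transpose B = B"
    by (simp add: transpose_def vec_eq_iff Bij Aij add.commute)
  ultimately have B: "symmetric_Z_matrix B"
    using A unfolding symmetric_Z_matrix_def irreducible_mat_def by meson
  have lV: "(\<chi> j. \<kappa> $ j * V $ j) = u"
    using Vpos by (simp add: \<kappa>_def vec_eq_iff less_imp_neq[symmetric])
  have BV: "(B *v V) $ i = (S *v u) $ i + \<kappa> $ i * b $ i" for i
    unfolding Bx lV S_def sensitivity_mult_nth using Vpos[of i]
    by (simp add: \<kappa>_def field_simps)
  have "B *v V \<noteq> 0"
  proof -
    obtain i where i: "b $ i \<noteq> 0"
      using b(2) by (auto simp: vec_eq_iff)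
    have "0 < \<kappa> $ i * b $ i"
      using lpos[of i] b(1)[of i] i by simp
    then have "0 < (B *v V) $ i"
      using Su[of i] by (simp add: BV S_def)
    then show ?thesis
      by auto
  qed
  moreover have "0 \<le> (B *v V) $ i" for i
    using Su[of i] lpos[of i] b(1)[of i] by (simp add: BV S_def)
  moreover have "0 \<lless> V"
    using V by (simp add: balance_def)
  ultimately obtain \<mu> where \<mu>: "0 < \<mu>" "\<And>x. \<mu> * (x \<bullet> x) \<le> x \<bullet> (B *v x)"
    using Z_matrix_semipositive_pos_def[OF B] by metis
  have "h \<noteq> 0"
    using \<open>V \<noteq> W\<close> by (simp add: h_def)
  then have "0 < \<mu> * (h \<bullet> h)"
    using \<mu>(1) by simp
  then have pos: "0 < h \<bullet> (B *v h)"
    using \<mu>(2)[of h] by linarith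
  \<comment> \<open>Equality of the demands at \<open>V\<close> and \<open>V - h\<close>: the linear
    term in \<open>h\<close> on the left balances the quadratic term on the right.\<close>
  have VS: "V $ i * (S *v h) $ i = h $ i * (A *v h) $ i" for i
  proof -
    have "V $ i * (b - A *v V) $ i = W $ i * (b - A *v W) $ i"
      using V W by (simp add: balance_def)
    moreover have "W = V - h"
      by (simp add: h_def)
    ultimately have "V $ i * (A *v h) $ i + (A *v V - b) $ i * h $ i = h $ i * (A *v h) $ i"
      by (simp add: matrix_vector_mult_diff_distrib algebra_simps)
    then show ?thesis
      using Vpos[of i] unfolding S_def sensitivity_mult_nth by (simp add: distrib_left)
  qed
  have uS: "u $ i * (S *v h) $ i = \<kappa> $ i * (h $ i * (A *v h) $ i)" for i
    using VS[of i] Vpos[of i] by (simp add: \<kappa>_def field_simps)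
  have "h \<bullet> (B *v h) = (\<Sum>i\<in>UNIV. \<kappa> $ i * (h $ i * (A *v h) $ i)) + h \<bullet> (A *v (\<chi> j. \<kappa> $ j * h $ j))"
    by (simp add: inner_vec_def Bx sum.distrib algebra_simps)
  also have "h \<bullet> (A *v (\<chi> j. \<kappa> $ j * h $ j)) = (\<Sum>i\<in>UNIV. \<kappa> $ i * (h $ i * (A *v h) $ i))"
    unfolding inner_symmetric_matrix[OF symA] by (simp add: inner_vec_def algebra_simps)
  also have "(\<Sum>i\<in>UNIV. \<kappa> $ i * (h $ i * (A *v h) $ i)) = u \<bullet> (S *v h)"
    by (simp add: inner_vec_def uS)
  also have "\<dots> = (S *v u) \<bullet> h"
    using symmetric_Z_matrix_sensitivity[OF A, of b V]
    by (simp add: S_def symmetric_Z_matrix_def inner_symmetric_matrix)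
  finally show ?thesis
    using pos by (simp add: S_def h_def)
qed

text \<open>A second operating point excludes the eigenvalue 0: its positive eigenvector would make
  the strictly positive inner product of \<open>balance_inner_pos\<close> vanish. So the sensitivity
  matrix is positive definite.\<close>

lemma balance_psd_dominates:
  fixes A :: "real ^ 'n::finite ^ 'n"
  assumes A: "symmetric_Z_matrix A" and b: "\<And>i. 0 \<le> b $ i" "b \<noteq> 0"
    and V: "balance A b p V" and W: "balance A b p W" and "V \<noteq> W"
    and psd: "\<And>v. 0 \<le> v \<bullet> (sensitivity A b V *v v)"
  shows "W \<lless> V"
proof -
  let ?S = "sensitivity A b V"
  note S = symmetric_Z_matrix_sensitivity[OF A, of b V]
  note pos = balance_inner_pos[OF A b V W \<open>V \<noteq> W\<close>]
  obtain \<mu> w where w: "0 \<lless> w" "?S *v w = \<mu> *\<^sub>R w" and ray: "\<And>u. \<mu> * (u \<bullet> u) \<le> u \<bullet> (?S *v u)"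
    using symmetric_Z_matrix_perron[OF S] by metis
  have "0 < w \<bullet> w"
    using w(1) by (auto simp: vec_less_def)
  moreover have "0 \<le> \<mu> * (w \<bullet> w)"
    using psd[of w] w(2) by simp
  ultimately have "0 \<le> \<mu>"
    by (meson mult_neg_pos not_le)
  moreover have "\<mu> \<noteq> 0"
    using pos[OF w(1)] w(2) by auto
  ultimately have "0 < \<mu>" by simp
  have "W $ i < V $ i" for i
  proof -
    \<comment> \<open>With \<open>?S *v u\<close> equal to the unit vector, the inner product with
      \<open>V - W\<close> is just coordinate \<open>i\<close> of that difference.\<close>
    define u where "u = matrix_inv ?S *v axis i 1"
    have Su: "?S *v u = axis i 1"
      unfolding u_def using pos_def_invertible[OF \<open>0 < \<mu>\<close> ray] by (rule matrix_inv_mult_vec)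
    have "0 \<lless> u"
      by (rule Z_matrix_inverse_positive[OF S w \<open>0 < \<mu>\<close>])
        (auto simp: Su axis_def vec_eq_iff)
    from pos[OF this] show ?thesis
      unfolding Su by (simp add: inner_axis' ) (simp add: axis_def)
  qed
  then show ?thesis
    by (simp add: vec_less_def)
qed

text \<open>A point of \<open>K\<close> with the largest coordinate sum has neither slack in a
  demand constraint nor a negative eigenvalue, since each would provide a direction that stays in
  \<open>K\<close> and raises the sum.\<close>

lemma balance_psd_exists:
  fixes A :: "real ^ 'n::finite ^ 'n"
  assumes A: "symmetric_Z_matrix A" and \<alpha>: "0 < \<alpha>" "\<And>u. \<alpha> * (u \<bullet> u) \<le> u \<bullet> (A *v u)"
    and V: "balance A b p V"
  obtains x where "balance A b p x" "\<And>v. 0 \<le> v \<bullet> (sensitivity A b x *v v)"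
proof -
  \<comment> \<open>The lower bound \<open>V\<close> keeps \<open>K\<close> inside the positive
    orthant while leaving it closed.\<close>
  define K where "K = {x. (\<forall>i. V $ i \<le> x $ i) \<and> (\<forall>i. p $ i \<le> x $ i * (b - A *v x) $ i)}"
  have cont: "continuous_on UNIV (\<lambda>x. (b - A *v x) $ i)" for i
    by (intro continuous_on_component continuous_on_diff continuous_on_const linear_continuous_on
        matrix_vector_mul_bounded_linear)
  have "closed K"
    unfolding K_def
    by (intro closed_Collect_conj closed_Collect_all closed_Collect_le continuous_on_mult cont
        continuous_on_const continuous_on_component continuous_on_id)
  moreover have "bounded K"
    unfolding bounded_iff
  proof (intro exI ballI)
    fix x assume x: "x \<in> K"
    define n where "n = norm x"
    define s where "s = \<bar>\<Sum>i\<in>UNIV. p $ i\<bar>"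
    \<comment> \<open>Summing the demand constraints gives
      \<open>\<alpha> * (n * n) \<le> n * norm b + s\<close>. For \<open>n > 1\<close> the term
      \<open>s\<close> is at most \<open>n * s\<close>, and a factor \<open>n\<close> cancels; the
      summand 1 in the bound covers the other case.\<close>
    show "norm x \<le> 1 + (norm b + \<bar>\<Sum>i\<in>UNIV. p $ i\<bar>) / \<alpha>"
    proof (cases "n \<le> 1")
      case True
      have "0 \<le> (norm b + s) / \<alpha>"
        using \<alpha>(1) by (simp add: s_def)
      with True show ?thesis
        by (simp add: n_def s_def)
    next
      case False
      have "(\<Sum>i\<in>UNIV. p $ i) \<le> x \<bullet> (b - A *v x)"
        using x unfolding K_def inner_vec_def by (auto intro: sum_mono)
      also have "\<dots> \<le> n * norm b - \<alpha> * (n * n)"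
        using \<alpha>(2)[of x] norm_cauchy_schwarz[of x b]
        by (simp add: inner_diff_right n_def power2_norm_eq_inner[symmetric] power2_eq_square)
      finally have "\<alpha> * (n * n) \<le> n * norm b + s"
        by (simp add: s_def)
      also have "\<dots> \<le> n * norm b + n * s"
        using False mult_right_mono[of 1 n s] by (simp add: s_def)
      finally have "n * (\<alpha> * n) \<le> n * (norm b + s)"
        by (simp add: algebra_simps)
      then have "\<alpha> * n \<le> norm b + s"
        using False by simp
      then have "n \<le> (norm b + s) / \<alpha>"
        using \<alpha>(1) by (simp add: pos_le_divide_eq mult.commute)
      then show ?thesis
        by (simp add: n_def s_def)
    qed
  qed
  ultimately have "compact K"
    by (simp add: compact_eq_bounded_closed)
  moreover have "V \<in> K"
    using V by (simp add: K_def balance_def)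
  moreover have "continuous_on K (\<lambda>x. \<Sum>i\<in>UNIV. x $ i)"
    by (intro continuous_on_sum continuous_on_component continuous_on_id)
  ultimately obtain x where x: "x \<in> K" and max: "\<And>y. y \<in> K \<Longrightarrow> (\<Sum>i\<in>UNIV. y $ i) \<le> (\<Sum>i\<in>UNIV. x $ i)"
    using continuous_attains_sup[of K "\<lambda>x. \<Sum>i\<in>UNIV. x $ i"] by blast
  define r where "r = b - A *v x"
  have px: "p $ i \<le> x $ i * r $ i" for i
    using x by (simp add: K_def r_def)
  have Vx: "V $ i \<le> x $ i" for i
    using x by (simp add: K_def)
  have xpos: "0 < x $ i" for i
    using V Vx[of i] by (auto simp: balance_def vec_less_def intro: less_le_trans)
  \<comment> \<open>A short move along \<open>w\<close> is feasible in coordinate \<open>i\<close>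
    if the constraint has slack or its derivative is positive. A derivative that is only nonnegative
    suffices where \<open>w $ i = 0\<close>, because the second-order term vanishes there.\<close>
  have no_ascent: False
    if w: "\<And>i. 0 \<le> w $ i" "w \<noteq> 0"
      and dir: "\<And>i. p $ i < x $ i * r $ i \<or> 0 < w $ i * r $ i - x $ i * (A *v w) $ i
                    \<or> w $ i = 0 \<and> 0 \<le> w $ i * r $ i - x $ i * (A *v w) $ i" for w
  proof -
    define g where "g i = w $ i * r $ i - x $ i * (A *v w) $ i" for i
    define c where "c i = w $ i * (A *v w) $ i" for i
    have val: "(x + t *\<^sub>R w) $ i * (b - A *v (x + t *\<^sub>R w)) $ i = x $ i * r $ i + t * (g i - t * c i)" for t i
      by (simp add: r_def g_def c_def matrix_vector_right_distrib matrix_vector_mult_scaleR algebra_simps)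
    have pos: "eventually (\<lambda>t::real. 0 < t) (at_right 0)"
      by (simp add: eventually_at_right_less)
    have "eventually (\<lambda>t. p $ i \<le> x $ i * r $ i + t * (g i - t * c i)) (at_right 0)" for i
      using dir[of i] unfolding g_def[symmetric]
    proof (elim disjE conjE)
      assume "p $ i < x $ i * r $ i"
      moreover have "((\<lambda>t. x $ i * r $ i + t * (g i - t * c i)) \<longlongrightarrow> x $ i * r $ i + 0 * (g i - 0 * c i)) (at_right 0)"
        by (intro tendsto_intros)
      ultimately have "eventually (\<lambda>t. p $ i < x $ i * r $ i + t * (g i - t * c i)) (at_right 0)"
        by (intro order_tendstoD(1)) auto
      then show ?thesis
        by eventually_elim simp
    next
      assume "0 < g i"
      moreover have "((\<lambda>t. g i - t * c i) \<longlongrightarrow> g i - 0 * c i) (at_right 0)"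
        by (intro tendsto_intros)
      ultimately have "eventually (\<lambda>t. 0 < g i - t * c i) (at_right 0)"
        by (intro order_tendstoD(1)) auto
      with pos show ?thesis
        by eventually_elim (use px[of i] in \<open>simp add: add_increasing2\<close>)
    next
      assume "w $ i = 0" "0 \<le> g i"
      then have "c i = 0"
        by (simp add: c_def)
      from pos show ?thesis
        by eventually_elim (use px[of i] \<open>0 \<le> g i\<close> \<open>c i = 0\<close> in \<open>simp add: add_increasing2\<close>)
    qed
    then have "eventually (\<lambda>t. \<forall>i. p $ i \<le> (x + t *\<^sub>R w) $ i * (b - A *v (x + t *\<^sub>R w)) $ i) (at_right 0)"
      unfolding val by (rule eventually_all_finite)
    with pos have "eventually (\<lambda>t. 0 < t \<and> (\<forall>i. p $ i \<le> (x + t *\<^sub>R w) $ i * (b - A *v (x + t *\<^sub>R w)) $ i)) (at_right 0)"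
      by (rule eventually_conj)
    from eventually_happens[OF this] obtain t where t: "0 < t" "\<And>i. p $ i \<le> (x + t *\<^sub>R w) $ i * (b - A *v (x + t *\<^sub>R w)) $ i"
      by (auto simp: trivial_limit_at_right_real)
    have "V $ i \<le> (x + t *\<^sub>R w) $ i" for i
      using Vx[of i] w(1)[of i] t(1) by (simp add: add_increasing2)
    with t(2) have "x + t *\<^sub>R w \<in> K"
      by (simp add: K_def)
    from max[OF this] have "t * (\<Sum>i\<in>UNIV. w $ i) \<le> 0"
      by (simp add: sum.distrib sum_distrib_left)
    moreover obtain i where "w $ i \<noteq> 0"
      using w(2) by (auto simp: vec_eq_iff)
    then have "0 < (\<Sum>i\<in>UNIV. w $ i)"
      using w(1) by (intro sum_pos2[of _ i]) (auto simp: less_le)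
    ultimately show False
      using t(1) by (simp add: mult_le_0_iff)
  qed
  have "x $ i * r $ i = p $ i" for i
  proof (rule ccontr)
    assume "x $ i * r $ i \<noteq> p $ i"
    then have less: "p $ i < x $ i * r $ i"
      using px[of i] by simp
    \<comment> \<open>Raising voltage \<open>i\<close> alone uses up slack at \<open>i\<close> only:
      for \<open>j \<noteq> i\<close> the derivative is \<open>- (x $ j * A $ j $ i)\<close>, which
      is nonnegative.\<close>
    show False
    proof (rule no_ascent[of "axis i 1"])
      fix j
      show "0 \<le> axis i (1::real) $ j"
        by (simp add: axis_def)
      have "A $ j $ i \<le> 0" if "j \<noteq> i"
        using A that by (simp add: symmetric_Z_matrix_def)
      then have "x $ j * A $ j $ i \<le> 0" if "j \<noteq> i"
        using that xpos[of j] by (simp add: mult_nonneg_nonpos)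
      then show "p $ j < x $ j * r $ j \<or> 0 < axis i 1 $ j * r $ j - x $ j * (A *v axis i 1) $ j
         \<or> axis i (1::real) $ j = 0 \<and> 0 \<le> axis i 1 $ j * r $ j - x $ j * (A *v axis i 1) $ j"
        using less by (cases "j = i") (auto simp: axis_def matrix_vector_mult_basis[unfolded axis_def] column_def)
    qed (simp add: axis_eq_0_iff)
  qed
  then have bal: "balance A b p x"
    using xpos by (simp add: balance_def vec_less_def r_def)
  let ?S = "sensitivity A b x"
  obtain \<mu> w where w: "0 \<lless> w" "?S *v w = \<mu> *\<^sub>R w" and ray: "\<And>u. \<mu> * (u \<bullet> u) \<le> u \<bullet> (?S *v u)"
    using symmetric_Z_matrix_perron[OF symmetric_Z_matrix_sensitivity[OF A]] by metis
  have "0 \<le> \<mu>"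
  proof (rule ccontr)
    assume "\<not> 0 \<le> \<mu>"
    \<comment> \<open>Along the Perron vector the derivative in coordinate \<open>i\<close> is
      \<open>- (\<mu> * x $ i * w $ i)\<close>, positive for negative \<mu>.\<close>
    show False
    proof (rule no_ascent[of w])
      fix i
      have wpos: "0 < w $ i"
        using w(1) by (simp add: vec_less_def)
      then show "0 \<le> w $ i" by simp
      have "w $ i * r $ i - x $ i * (A *v w) $ i = - (x $ i * (?S *v w) $ i)"
        unfolding sensitivity_mult_nth r_def using xpos[of i] by (simp add: field_simps)
      also have "0 < \<dots>"
        using \<open>\<not> 0 \<le> \<mu>\<close> xpos[of i] wpos by (simp add: w(2) mult_pos_neg mult_neg_pos)
      finally show "p $ i < x $ i * r $ i \<or> 0 < w $ i * r $ i - x $ i * (A *v w) $ i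
         \<or> w $ i = 0 \<and> 0 \<le> w $ i * r $ i - x $ i * (A *v w) $ i"
        by simp
    qed (use w(1) in \<open>auto simp: vec_less_def\<close>)
  qed
  then have "0 \<le> v \<bullet> (?S *v v)" for v
    using ray[of v] by (meson inner_ge_zero mult_nonneg_nonneg order_trans)
  with bal show ?thesis
    using that by blast
qed

section \<open>Consequences of the Kirchhoff structure\<close>

lemma sum_UNIV_sum_type:
  fixes f :: "'a::finite + 'b::finite \<Rightarrow> real"
  shows "sum f UNIV = (\<Sum>i\<in>UNIV. f (Inl i)) + (\<Sum>j\<in>UNIV. f (Inr j))"
  unfolding UNIV_Plus_UNIV[symmetric] by (subst sum.Plus) (simp_all add: comp_def)

text \<open>Nonvanishing rests on connectedness: without an edge between a load and a source, only
  loads could be reached from a load. Here \<open>undefined\<close> serves as an arbitrary load or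
  source.\<close>

lemma I_star_nonneg_nonzero:
  fixes Y :: "real ^ ('l::finite + 's::finite) ^ ('l + 's)"
  assumes Y: "kirchhoff_matrix Y" and c: "0 \<lless> c"
  shows "0 \<le> I_star Y c $ i" and "I_star Y c \<noteq> 0"
proof -
  have cpos: "0 < c $ j" for j
    using c by (simp add: vec_less_def)
  have off: "Y $ Inl i $ Inr j \<le> 0" for i j
    using Y by (simp add: kirchhoff_matrix_def)
  have I: "I_star Y c $ i = (\<Sum>j\<in>UNIV. - Y $ Inl i $ Inr j * c $ j)" for i
    by (simp add: I_star_def Y_LS_def matrix_vector_mult_def sum_negf)
  have nonneg: "0 \<le> - Y $ Inl i $ Inr j * c $ j" for i j
    using off[of i j] cpos[of j] by (simp add: mult_nonpos_nonneg less_imp_le)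
  then show "0 \<le> I_star Y c $ i"
    unfolding I by (intro sum_nonneg)
  have "\<exists>i j. Y $ Inl i $ Inr j \<noteq> 0"
  proof (rule ccontr)
    assume *: "\<not> (\<exists>i j. Y $ Inl i $ Inr j \<noteq> 0)"
    have "k \<in> range Inl" if "(Inl undefined, k) \<in> {(k, l). k \<noteq> l \<and> Y $ k $ l < 0}\<^sup>*" for k :: "'l + 's"
      using that
    proof (induction rule: rtrancl_induct)
      case (step y z)
      with * show ?case
        by (cases z) auto
    qed simp
    moreover have "(Inl undefined, Inr undefined) \<in> {(k, l). k \<noteq> l \<and> Y $ k $ l < 0}\<^sup>*"
      using Y unfolding kirchhoff_matrix_def by blast
    ultimately show False
      by blast
  qed
  then obtain i j where "Y $ Inl i $ Inr j \<noteq> 0" by blast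
  then have "0 < - Y $ Inl i $ Inr j * c $ j"
    using off[of i j] cpos[of j] by (simp add: mult_neg_pos)
  then have "0 < I_star Y c $ i"
    unfolding I using nonneg by (intro sum_pos2[of _ j]) auto
  then show "I_star Y c \<noteq> 0"
    by auto
qed

lemma dc_power_grid_Y_LL:
  assumes "dc_power_grid Y V\<^sub>S"
  shows "symmetric_Z_matrix (Y_LL Y)"
  using assms unfolding dc_power_grid_def kirchhoff_matrix_def symmetric_Z_matrix_def
  by (simp add: Y_LL_def transpose_def vec_eq_iff)

lemma Y_LL_pos_def:
  fixes Y :: "real ^ ('l::finite + 's::finite) ^ ('l + 's)"
  assumes grid: "dc_power_grid Y V\<^sub>S"
  obtains \<mu> where "0 < \<mu>" "\<And>u. \<mu> * (u \<bullet> u) \<le> u \<bullet> (Y_LL Y *v u)"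
proof -
  have Y: "kirchhoff_matrix Y"
    using grid by (simp add: dc_power_grid_def)
  \<comment> \<open>Zero row sums turn the all-ones vector into a certificate of definiteness: its
    image is the current injected by unit source voltages, nonnegative and nonzero.\<close>
  have "(Y_LL Y *v 1) $ i = I_star Y 1 $ i" for i
  proof -
    have "(\<Sum>j\<in>UNIV. Y $ Inl i $ j) = 0"
      using Y by (simp add: kirchhoff_matrix_def)
    then show ?thesis
      by (simp add: sum_UNIV_sum_type I_star_def Y_LL_def Y_LS_def matrix_vector_mult_def)
  qed
  then have eq: "Y_LL Y *v 1 = I_star Y 1"
    by (simp add: vec_eq_iff)
  have "0 \<lless> (1::real^'l)" "0 \<lless> (1::real^'s)"
    by (simp_all add: vec_less_def)
  then show ?thesis
    using Z_matrix_semipositive_pos_def[OF dc_power_grid_Y_LL[OF grid], of 1] that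
      I_star_nonneg_nonzero[OF Y, of 1] unfolding eq by metis
qed

lemma Y_LL_V_star:
  assumes "dc_power_grid Y V\<^sub>S"
  shows "Y_LL Y *v V_star Y V\<^sub>S = I_star Y V\<^sub>S"
  unfolding V_star_def using assms Y_LL_pos_def pos_def_invertible matrix_inv_mult_vec(1) by metis

lemma operating_point_iff_balance:
  assumes "dc_power_grid Y V\<^sub>S"
  shows "operating_point Y V\<^sub>S P V \<longleftrightarrow> balance (Y_LL Y) (I_star Y V\<^sub>S) P V"
  by (simp add: operating_point_def balance_def P_c_def diag_mult_vec vec_eq_iff
      matrix_vector_mult_diff_distrib Y_LL_V_star[OF assms] right_diff_distrib)

section \<open>The stable set and its closure\<close>

lemma jacobian_mult_nth:
  assumes "dc_power_grid Y V\<^sub>S" and "0 \<lless> x"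
  shows "(jacobian (P_c Y V\<^sub>S) (at x) *v y) $ i =
    - (x $ i * (sensitivity (Y_LL Y) (I_star Y V\<^sub>S) x *v y) $ i)"
proof -
  have "0 < x $ i"
    using assms(2) by (simp add: vec_less_def)
  then show ?thesis
    unfolding jacobian_P_c sensitivity_mult_nth
    by (simp add: matrix_vector_mult_diff_rdistrib matrix_vector_mul_assoc[symmetric] diag_mult_vec
        matrix_vector_mult_diff_distrib Y_LL_V_star[OF assms(1)] field_simps)
qed

text \<open>If the inverse Jacobian is negative, applying it to the image of \<open>w\<close>
  exhibits \<open>w $ i\<close> as \<mu> times a nonnegative sum, so \<mu> is positive. Conversely,
  for positive \<mu> inverse positivity of the sensitivity matrix makes every column of the negated
  inverse Jacobian positive.\<close>

lemma stable_set_iff: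
  fixes Y :: "real ^ ('l::finite + 's::finite) ^ ('l + 's)"
  assumes grid: "dc_power_grid Y V\<^sub>S" and x: "0 \<lless> x"
    and w: "0 \<lless> w" "sensitivity (Y_LL Y) (I_star Y V\<^sub>S) x *v w = \<mu> *\<^sub>R w"
    and ray: "\<And>u. \<mu> * (u \<bullet> u) \<le> u \<bullet> (sensitivity (Y_LL Y) (I_star Y V\<^sub>S) x *v u)"
  shows "x \<in> stable_set Y V\<^sub>S \<longleftrightarrow> 0 < \<mu>"
proof
  let ?S = "sensitivity (Y_LL Y) (I_star Y V\<^sub>S) x"
  let ?J = "jacobian (P_c Y V\<^sub>S) (at x)"
  note J = jacobian_mult_nth[OF grid x]
  have xpos: "0 < x $ i" and wpos: "0 < w $ i" for i
    using x w(1) by (simp_all add: vec_less_def)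
  {
    assume "x \<in> stable_set Y V\<^sub>S"
    then have inv: "invertible ?J" and neg: "\<And>i j. matrix_inv ?J $ i $ j < 0"
      by (auto simp: stable_set_def)
    fix i :: 'l
    have "w $ i = (matrix_inv ?J *v (?J *v w)) $ i"
      using matrix_inv_mult_vec(2)[OF inv] by simp
    also have "\<dots> = \<mu> * (\<Sum>j\<in>UNIV. - matrix_inv ?J $ i $ j * (x $ j * w $ j))"
      unfolding matrix_vector_mult_def[of "matrix_inv ?J"] J w(2)
      by (simp add: sum_distrib_left algebra_simps)
    finally have "0 < \<mu> * (\<Sum>j\<in>UNIV. - matrix_inv ?J $ i $ j * (x $ j * w $ j))"
      using wpos[of i] by simp
    moreover have "0 \<le> (\<Sum>j\<in>UNIV. - matrix_inv ?J $ i $ j * (x $ j * w $ j))"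
      using neg xpos wpos by (intro sum_nonneg mult_nonneg_nonneg) (auto intro: less_imp_le)
    ultimately show "0 < \<mu>"
      by (simp add: zero_less_mult_iff)
  next
    assume "0 < \<mu>"
    note S = symmetric_Z_matrix_sensitivity[OF dc_power_grid_Y_LL[OF grid]]
    have S_inv: "invertible ?S"
      using \<open>0 < \<mu>\<close> ray by (rule pos_def_invertible)
    have "v = 0" if "?J *v v = 0" for v
    proof -
      have "(?S *v v) $ i = 0" for i
        using that J[of v i] xpos[of i] by simp
      then have "?S *v v = 0"
        by (simp add: vec_eq_iff)
      then show ?thesis
        using matrix_inv_mult_vec(2)[OF S_inv, of v] by simp
    qed
    then have J_inv: "invertible ?J"
      by (simp add: invertible_left_inverse matrix_left_invertible_ker)
    moreover have "matrix_inv ?J $ i $ j < 0" for i j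
    proof -
      \<comment> \<open>Column \<open>j\<close> of the negated inverse Jacobian;
        \<open>?S *v y\<close> is then a positive multiple of a unit vector.\<close>
      define y where "y = - (matrix_inv ?J *v axis j 1)"
      have "?J *v y = - axis j 1"
        unfolding y_def using matrix_inv_mult_vec(1)[OF J_inv, of "axis j 1"]
        by (metis linear_neg matrix_vector_mul_linear)
      then have Sy: "x $ k * (?S *v y) $ k = axis j 1 $ k" for k
        using J[of y k] by simp
      have "0 \<le> x $ k * (?S *v y) $ k" for k
        unfolding Sy by (simp add: axis_def)
      then have "0 \<le> (?S *v y) $ k" for k
        using xpos[of k] zero_le_mult_iff[of "x $ k" "(?S *v y) $ k"] by (metis not_le)
      moreover have "?S *v y \<noteq> 0"
        using Sy[of j] by auto
      ultimately have "0 \<lless> y"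
        by (intro Z_matrix_inverse_positive[OF S w \<open>0 < \<mu>\<close>])
      then have "0 < y $ i"
        by (simp add: vec_less_def)
      then show ?thesis
        by (simp add: y_def matrix_vector_mult_basis column_def)
    qed
    ultimately show "x \<in> stable_set Y V\<^sub>S"
      using x by (simp add: stable_set_def)
  }
qed

text \<open>Definiteness at stable points passes to the limit as semidefiniteness, the quotients
  being continuous at the positive point \<open>V\<close>. Conversely, the points
  \<open>s *\<^sub>R V\<close> with \<open>s > 1\<close> are stable and tend to
  \<open>V\<close>.\<close>

lemma semi_stable_iff_psd:
  fixes Y :: "real ^ ('l::finite + 's::finite) ^ ('l + 's)"
  assumes grid: "dc_power_grid Y V\<^sub>S" and V: "0 \<lless> V"
  shows "semi_stable Y V\<^sub>S V \<longleftrightarrow>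
    (\<forall>v. 0 \<le> v \<bullet> (sensitivity (Y_LL Y) (I_star Y V\<^sub>S) V *v v))"
proof
  let ?A = "Y_LL Y" and ?b = "I_star Y V\<^sub>S"
  let ?S = "sensitivity ?A ?b"
  note S = symmetric_Z_matrix_sensitivity[OF dc_power_grid_Y_LL[OF grid], of ?b]
  have Vpos: "0 < V $ i" for i
    using V by (simp add: vec_less_def)
  {
    assume "semi_stable Y V\<^sub>S V"
    then obtain X where X: "\<And>n. X n \<in> stable_set Y V\<^sub>S" and lim: "X \<longlonglongrightarrow> V"
      unfolding semi_stable_def closure_sequential by blast
    show "\<forall>v. 0 \<le> v \<bullet> (?S V *v v)"
    proof
      fix v
      have "0 \<le> v \<bullet> (?S (X n) *v v)" for n
      proof -
        obtain \<mu> w where w: "0 \<lless> w" "?S (X n) *v w = \<mu> *\<^sub>R w"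
          and ray: "\<And>u. \<mu> * (u \<bullet> u) \<le> u \<bullet> (?S (X n) *v u)"
          using symmetric_Z_matrix_perron[OF S] by metis
        have "0 \<lless> X n"
          using X[of n] by (simp add: stable_set_def)
        then have "0 < \<mu>"
          using X[of n] stable_set_iff[OF grid _ w ray] by simp
        then show ?thesis
          using ray[of v] by (meson inner_ge_zero less_imp_le mult_nonneg_nonneg order_trans)
      qed
      moreover have "(\<lambda>n. ?A *v X n) \<longlonglongrightarrow> ?A *v V"
        by (intro bounded_linear.tendsto[OF matrix_vector_mul_bounded_linear] lim)
      then have "(\<lambda>n. v \<bullet> (?S (X n) *v v)) \<longlonglongrightarrow> v \<bullet> (?S V *v v)"
        unfolding inner_vec_def sensitivity_mult_nth
        using Vpos by (intro tendsto_intros lim) (auto simp: less_imp_neq[symmetric])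
      ultimately show "0 \<le> v \<bullet> (?S V *v v)"
        by (intro LIMSEQ_le_const) auto
    qed
  next
    assume psd: "\<forall>v. 0 \<le> v \<bullet> (?S V *v v)"
    have "s *\<^sub>R V \<in> stable_set Y V\<^sub>S" if s: "1 < s" for s
    proof -
      obtain \<mu> w where w: "0 \<lless> w" "?S (s *\<^sub>R V) *v w = \<mu> *\<^sub>R w"
        and ray: "\<And>u. \<mu> * (u \<bullet> u) \<le> u \<bullet> (?S (s *\<^sub>R V) *v u)"
        using symmetric_Z_matrix_perron[OF S] by metis
      have wpos: "0 < w $ i" for i
        using w(1) by (simp add: vec_less_def)
      \<comment> \<open>The gain in \<open>?S\<close> from scaling \<open>V\<close> by
        \<open>s\<close>, applied to the Perron vector at the scaled point. It is nonnegative and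
        nonzero because the injected currents are, which forces \<mu> to be positive.\<close>
      define d where "d = (\<chi> i. (1 - 1 / s) * (?b $ i / V $ i * w $ i))"
      have "(?S (s *\<^sub>R V) *v w) $ i = (?S V *v w + d) $ i" for i
        using Vpos[of i] s unfolding vector_add_component sensitivity_mult_nth d_def
        by (simp add: matrix_vector_mult_scaleR field_simps)
      then have eq: "?S (s *\<^sub>R V) *v w = ?S V *v w + d"
        by (simp add: vec_eq_iff)
      have b: "0 \<le> ?b $ i" "?b \<noteq> 0" for i
        using grid I_star_nonneg_nonzero[of Y V\<^sub>S] by (simp_all add: dc_power_grid_def)
      have "0 \<le> d $ i" for i
        using b(1)[of i] Vpos[of i] wpos[of i] s by (simp add: d_def)
      moreover obtain i where "?b $ i \<noteq> 0"
        using b(2) by (auto simp: vec_eq_iff)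
      then have "d $ i \<noteq> 0"
        using Vpos[of i] wpos[of i] s by (simp add: d_def)
      then have "d \<noteq> 0"
        by auto
      ultimately have "0 < w \<bullet> d"
        using w(1) by (intro inner_pos)
      also have "\<dots> \<le> w \<bullet> (?S (s *\<^sub>R V) *v w)"
        using psd[rule_format, of w] by (simp add: eq inner_add_right)
      also have "\<dots> = \<mu> * (w \<bullet> w)"
        by (simp add: w(2))
      finally have "0 < \<mu>"
        by (metis inner_ge_zero mult_nonpos_nonneg not_le)
      moreover have "0 \<lless> s *\<^sub>R V"
        using Vpos s by (simp add: vec_less_def)
      ultimately show ?thesis
        using stable_set_iff[OF grid _ w ray] by simp
    qed
    then have "(1 + inverse (real (Suc n))) *\<^sub>R V \<in> stable_set Y V\<^sub>S" for n
      by simp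
    moreover have "(\<lambda>n. (1 + inverse (real (Suc n))) *\<^sub>R V) \<longlonglongrightarrow> 1 *\<^sub>R V"
      by (intro tendsto_scaleR LIMSEQ_inverse_real_of_nat_add tendsto_const)
    ultimately show "semi_stable Y V\<^sub>S V"
      unfolding semi_stable_def closure_sequential scaleR_one by (intro exI conjI allI)
  }
qed

section \<open>Dissipation at operating points and the equivalences\<close>

text \<open>Block expansion: by symmetry the two load-source cross terms agree, and the last summand
  depends on the sources alone.\<close>

lemma dissipation_eq:
  fixes Y :: "real ^ ('l::finite + 's::finite) ^ ('l + 's)"
  assumes "transpose Y = Y"
  shows "dissipation Y V V\<^sub>S = V \<bullet> (Y_LL Y *v V) - 2 * (V \<bullet> I_star Y V\<^sub>S)
    + V\<^sub>S \<bullet> ((\<chi> i j. Y $ Inr i $ Inr j) *v V\<^sub>S)"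
proof -
  have sym: "Y $ Inr j $ Inl i = Y $ Inl i $ Inr j" for i j
  proof -
    have "transpose Y $ Inl i $ Inr j = Y $ Inr j $ Inl i"
      by (simp add: transpose_def)
    then show ?thesis
      by (simp add: assms)
  qed
  have "(\<Sum>j\<in>UNIV. \<Sum>i\<in>UNIV. V\<^sub>S $ j * (Y $ Inr j $ Inl i * V $ i)) =
      (\<Sum>i\<in>UNIV. \<Sum>j\<in>UNIV. V $ i * (Y $ Inl i $ Inr j * V\<^sub>S $ j))"
    by (subst sum.swap) (simp add: sym ac_simps)
  then show ?thesis
    by (simp add: dissipation_def stack_def inner_vec_def matrix_vector_mult_def sum_UNIV_sum_type
        Y_LL_def I_star_def Y_LS_def sum_distrib_left distrib_left sum.distrib sum_negf)
qed

text \<open>Summing the balance equations replaces the quadratic term by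
  \<open>x \<bullet> I_star Y V\<^sub>S\<close> minus the total demand. What remains of the
  dissipation is a constant minus that same inner product.\<close>

lemma dissipation_operating_point_le_iff:
  fixes Y :: "real ^ ('l::finite + 's::finite) ^ ('l + 's)"
  assumes grid: "dc_power_grid Y V\<^sub>S"
    and "operating_point Y V\<^sub>S P V" "operating_point Y V\<^sub>S P W"
  shows "dissipation Y V V\<^sub>S \<le> dissipation Y W V\<^sub>S \<longleftrightarrow> W \<bullet> I_star Y V\<^sub>S \<le> V \<bullet> I_star Y V\<^sub>S"
proof -
  have sym: "transpose Y = Y"
    using grid by (simp add: dc_power_grid_def kirchhoff_matrix_def)
  have "x \<bullet> (Y_LL Y *v x) = x \<bullet> I_star Y V\<^sub>S - (\<Sum>i\<in>UNIV. P $ i)" if "operating_point Y V\<^sub>S P x" for x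
  proof -
    have "(\<Sum>i\<in>UNIV. P $ i) = x \<bullet> (I_star Y V\<^sub>S - Y_LL Y *v x)"
      using that unfolding operating_point_iff_balance[OF grid] by (simp add: balance_def inner_vec_def)
    then show ?thesis
      by (simp add: inner_diff_right)
  qed
  then show ?thesis
    using assms(2,3) by (simp add: dissipation_eq[OF sym])
qed

theorem theorem5p2:
  fixes Y :: "real ^ ('l::finite + 's::finite) ^ ('l + 's)"
    and V\<^sub>S :: "real ^ 's"
    and P V :: "real ^ 'l"
  assumes grid: "dc_power_grid Y V\<^sub>S"
    and feas: "feasible Y V\<^sub>S P"
    and op: "operating_point Y V\<^sub>S P V"
  shows "(semi_stable Y V\<^sub>S V \<longleftrightarrow>
            operating_point Y V\<^sub>S P V \<and> semi_stable Y V\<^sub>S V \<and>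
            (\<forall>W. operating_point Y V\<^sub>S P W \<and> semi_stable Y V\<^sub>S W \<longrightarrow> W = V)) \<and>
         (semi_stable Y V\<^sub>S V \<longleftrightarrow> dissipation_minimizing Y V\<^sub>S P V) \<and>
         (semi_stable Y V\<^sub>S V \<longleftrightarrow>
            dissipation_minimizing Y V\<^sub>S P V \<and>
            (\<forall>W. dissipation_minimizing Y V\<^sub>S P W \<longrightarrow> W = V)) \<and>
         (semi_stable Y V\<^sub>S V \<longleftrightarrow> high_voltage_solution Y V\<^sub>S P V) \<and>
         (semi_stable Y V\<^sub>S V \<longleftrightarrow> strict_high_voltage_solution Y V\<^sub>S P V)"
proof -
  let ?op = "operating_point Y V\<^sub>S P" and ?b = "I_star Y V\<^sub>S"
  note A = dc_power_grid_Y_LL[OF grid]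
  have b: "0 \<le> ?b $ i" "?b \<noteq> 0" for i
    using grid I_star_nonneg_nonzero[of Y V\<^sub>S] by (simp_all add: dc_power_grid_def)
  have psd: "semi_stable Y V\<^sub>S x \<longleftrightarrow> (\<forall>v. 0 \<le> v \<bullet> (sensitivity (Y_LL Y) ?b x *v v))" if "?op x" for x
    using that semi_stable_iff_psd[OF grid] by (simp add: operating_point_def)
  have dominates: "W \<lless> x" if "?op x" "semi_stable Y V\<^sub>S x" "?op W" "W \<noteq> x" for x W
    using balance_psd_dominates[OF A b, of P x W] that psd[of x]
    by (simp add: operating_point_iff_balance[OF grid])
  have less_inner: "W \<bullet> ?b < x \<bullet> ?b" if "W \<lless> x" for W x
    using inner_pos[of "x - W" ?b] b that by (simp add: vec_less_def inner_diff_left)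
  have irrefl: "\<not> (W \<lless> x \<and> x \<le> W)" for x W :: "real ^ 'l"
    by (auto simp: vec_less_def less_eq_vec_def not_le[symmetric])
  obtain \<mu> where \<mu>: "0 < \<mu>" "\<And>u. \<mu> * (u \<bullet> u) \<le> u \<bullet> (Y_LL Y *v u)"
    using Y_LL_pos_def[OF grid] by metis
  \<comment> \<open>This semi-stable point is the reference: each of the six statements is shown to
    amount to \<open>V = x\<close>.\<close>
  obtain x where x: "?op x" "semi_stable Y V\<^sub>S x"
    using balance_psd_exists[OF A \<mu>, of ?b P V] op psd
    unfolding operating_point_iff_balance[OF grid] by metis
  have le_iff: "dissipation Y z V\<^sub>S \<le> dissipation Y W V\<^sub>S \<longleftrightarrow> W \<bullet> ?b \<le> z \<bullet> ?b" if "?op z" "?op W" for z W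
    using dissipation_operating_point_le_iff[OF grid that] .
  have le_x: "W \<le> x" "W \<bullet> ?b \<le> x \<bullet> ?b" if "?op W" for W
    using dominates[OF x that] less_inner[of W x]
    by (cases "W = x"; force simp: vec_less_def less_eq_vec_def less_imp_le)+
  \<comment> \<open>Two distinct semi-stable operating points would strictly dominate each
    other.\<close>
  have semi: "semi_stable Y V\<^sub>S W \<longleftrightarrow> W = x" if "?op W" for W
    using dominates[OF x that] dominates[OF that _ x(1)] x(2)
    by (metis vec_less_def less_asym)
  \<comment> \<open>Strict domination makes the inner product with the nonnegative, nonzero currents
    strictly larger at \<open>x\<close>, so every other operating point dissipates strictly
    more.\<close>
  have diss: "dissipation_minimizing Y V\<^sub>S P W \<longleftrightarrow> W = x" for W
    unfolding dissipation_minimizing_def using x(1) le_iff le_x dominates[OF x, of W] less_inner[of W x]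
    by (metis not_le)
  have high: "high_voltage_solution Y V\<^sub>S P V \<longleftrightarrow> V = x"
    unfolding high_voltage_solution_def using x(1) op le_x irrefl[of V x] dominates[OF x op] by metis
  have strict: "strict_high_voltage_solution Y V\<^sub>S P V \<longleftrightarrow> V = x"
    unfolding strict_high_voltage_solution_def using x op dominates by (metis vec_less_def less_asym)
  show ?thesis
    using semi diss high strict op by metis
qed

end
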